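(* Let $M=\mathbf{R}^2$ with global coordinates $(x^0,x^1)$ and let $g=-a(x^0)(dx^0)^2+b(x^0)(dx^1)^2$, where $a,b\in C^1(\mathbf{R})$ are strictly positive functions. Then $(M,g)$ is causally non-branching and non-intertwining.
   Context: **Geodesic**: a $C^2$-curve $\gamma\colon I\to M$ solving $\ddot\gamma^k+\sum_{i,j}\Gamma^k_{ij}\dot\gamma^i\dot\gamma^j=0$, where $\Gamma^k_{ij}$ are the (continuous) Christoffel symbols of the $C^1$ metric $g$. It is causal if its tangent vector is causal ($g(\dot\gamma,\dot\gamma)\le 0$, non-trivial). **Causally non-branching**: no causal geodesic branches. A geodesic $\gamma\colon[a,b]\to M$ branches at $t_0\in(a,b)$ if there exist $\epsilon>0$ (with $(t_0-\epsilon,t_0+\epsilon)\subset[a,b]$) and a geodesic $\sigma\colon(t_0-\epsilon,t_0+\epsilon)\to M$ with $\gamma|_{(t_0-\epsilon,t_0]}=\sigma|_{(t_0-\epsilon,t_0]}$ and $\gamma((t_0,t_0+\epsilon))\cap\sigma((t_0,t_0+\epsilon))=\emptyset$. **Non-intertwining**: every $p\in M$ has a neighborhood $U$ such that for any $\varepsilon>0$ and any causal geodesics $\gamma_1,\gamma_2\colon[0,\varepsilon]\to U$ starting at $p$ with the same initial velocity, either $\gamma_1(t)=\gamma_2(t)$ for all $t\in[0,\varepsilon]$, or $\gamma_1((0,\varepsilon])\cap\gamma_2((0,\varepsilon])$ has no accumulation point (in $M$). *)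

theory Defs
  imports "HOL-Analysis.Analysis"
begin

text \<open>
  The manifold is \<open>real ^ 'n\<close> with its global coordinates, so a metric is given by its matrix
  of components \<open>g x $ i $ j\<close>. Curves are total functions of which only the restriction to the
  parameter interval \<open>I\<close> matters; all derivatives along a curve are taken within \<open>I\<close>, i.e. they
  are one-sided at the end points belonging to \<open>I\<close>.
\<close>

definition metric_form :: "(real ^ 'n \<Rightarrow> real ^ 'n ^ 'n) \<Rightarrow> real ^ 'n \<Rightarrow> real ^ 'n \<Rightarrow> real ^ 'n \<Rightarrow> real"
  where "metric_form g x v w = (\<Sum>i\<in>UNIV. \<Sum>j\<in>UNIV. g x $ i $ j * v $ i * w $ j)"

definition coord_deriv :: "'n \<Rightarrow> (real ^ 'n \<Rightarrow> real) \<Rightarrow> real ^ 'n \<Rightarrow> real"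
  where "coord_deriv i f x = deriv (\<lambda>h. f (x + h *\<^sub>R axis i 1)) 0"

definition christoffel ::
    "(real ^ 'n \<Rightarrow> real ^ 'n ^ 'n) \<Rightarrow> 'n \<Rightarrow> 'n \<Rightarrow> 'n \<Rightarrow> real ^ 'n \<Rightarrow> real"
  where "christoffel g k i j x =
    (\<Sum>l\<in>UNIV. matrix_inv (g x) $ k $ l *
       (coord_deriv i (\<lambda>y. g y $ l $ j) x + coord_deriv j (\<lambda>y. g y $ l $ i) x
        - coord_deriv l (\<lambda>y. g y $ i $ j) x)) / 2"

definition velocity :: "real set \<Rightarrow> (real \<Rightarrow> real ^ 'n) \<Rightarrow> real \<Rightarrow> real ^ 'n"
  where "velocity I \<gamma> t = vector_derivative \<gamma> (at t within I)"

definition C2_curve_on :: "real set \<Rightarrow> (real \<Rightarrow> real ^ 'n) \<Rightarrow> bool"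
  where "C2_curve_on I \<gamma> \<longleftrightarrow>
    \<gamma> differentiable_on I \<and> velocity I \<gamma> differentiable_on I \<and>
    continuous_on I (velocity I (velocity I \<gamma>))"

definition geodesic_on :: "(real ^ 'n \<Rightarrow> real ^ 'n ^ 'n) \<Rightarrow> real set \<Rightarrow> (real \<Rightarrow> real ^ 'n) \<Rightarrow> bool"
  where "geodesic_on g I \<gamma> \<longleftrightarrow> C2_curve_on I \<gamma> \<and>
    (\<forall>t\<in>I. \<forall>k. velocity I (velocity I \<gamma>) t $ k +
       (\<Sum>i\<in>UNIV. \<Sum>j\<in>UNIV.
          christoffel g k i j (\<gamma> t) * velocity I \<gamma> t $ i * velocity I \<gamma> t $ j) = 0)"

definition causal_vector :: "(real ^ 'n \<Rightarrow> real ^ 'n ^ 'n) \<Rightarrow> real ^ 'n \<Rightarrow> real ^ 'n \<Rightarrow> bool"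
  where "causal_vector g x v \<longleftrightarrow> v \<noteq> 0 \<and> metric_form g x v v \<le> 0"

definition causal_geodesic_on ::
    "(real ^ 'n \<Rightarrow> real ^ 'n ^ 'n) \<Rightarrow> real set \<Rightarrow> (real \<Rightarrow> real ^ 'n) \<Rightarrow> bool"
  where "causal_geodesic_on g I \<gamma> \<longleftrightarrow>
    geodesic_on g I \<gamma> \<and> (\<forall>t\<in>I. causal_vector g (\<gamma> t) (velocity I \<gamma> t))"

text \<open>The competing geodesic \<open>\<sigma>\<close> is not required to be causal.\<close>

definition branches_at ::
    "(real ^ 'n \<Rightarrow> real ^ 'n ^ 'n) \<Rightarrow> real \<Rightarrow> real \<Rightarrow> (real \<Rightarrow> real ^ 'n) \<Rightarrow> real \<Rightarrow> bool"
  where "branches_at g a b \<gamma> t0 \<longleftrightarrow>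
    (\<exists>\<epsilon>>0. \<exists>\<sigma>. {t0 - \<epsilon><..<t0 + \<epsilon>} \<subseteq> {a..b} \<and>
       geodesic_on g {t0 - \<epsilon><..<t0 + \<epsilon>} \<sigma> \<and>
       (\<forall>t\<in>{t0 - \<epsilon><..t0}. \<gamma> t = \<sigma> t) \<and>
       \<gamma> ` {t0<..<t0 + \<epsilon>} \<inter> \<sigma> ` {t0<..<t0 + \<epsilon>} = {})"

definition causally_non_branching :: "(real ^ 'n \<Rightarrow> real ^ 'n ^ 'n) \<Rightarrow> bool"
  where "causally_non_branching g \<longleftrightarrow>
    (\<forall>a b \<gamma>. a < b \<and> causal_geodesic_on g {a..b} \<gamma> \<longrightarrow>
       \<not> (\<exists>t0\<in>{a<..<b}. branches_at g a b \<gamma> t0))"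

definition non_intertwining :: "(real ^ 'n \<Rightarrow> real ^ 'n ^ 'n) \<Rightarrow> bool"
  where "non_intertwining g \<longleftrightarrow>
    (\<forall>p. \<exists>U. p \<in> interior U \<and>
       (\<forall>\<epsilon>>0. \<forall>\<gamma>1 \<gamma>2.
          causal_geodesic_on g {0..\<epsilon>} \<gamma>1 \<and> \<gamma>1 ` {0..\<epsilon>} \<subseteq> U \<and>
          causal_geodesic_on g {0..\<epsilon>} \<gamma>2 \<and> \<gamma>2 ` {0..\<epsilon>} \<subseteq> U \<and>
          \<gamma>1 0 = p \<and> \<gamma>2 0 = p \<and> velocity {0..\<epsilon>} \<gamma>1 0 = velocity {0..\<epsilon>} \<gamma>2 0 \<longrightarrow>
          (\<forall>t\<in>{0..\<epsilon>}. \<gamma>1 t = \<gamma>2 t) \<or>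
          \<not> (\<exists>q. q islimpt (\<gamma>1 ` {0<..\<epsilon>} \<inter> \<gamma>2 ` {0<..\<epsilon>}))))"

text \<open>
  The index type \<open>2\<close> has exactly the elements \<open>0\<close> and \<open>1\<close> (and \<open>2 = 0\<close> in it), so \<open>x $ 0\<close> and
  \<open>x $ 1\<close> are the coordinates \<open>x\<^sup>0\<close> and \<open>x\<^sup>1\<close>. The metric below is
  \<open>- a(x\<^sup>0) (dx\<^sup>0)\<^sup>2 + b(x\<^sup>0) (dx\<^sup>1)\<^sup>2\<close>.
\<close>

definition time_dependent_metric :: "(real \<Rightarrow> real) \<Rightarrow> (real \<Rightarrow> real) \<Rightarrow> real ^ 2 \<Rightarrow> real ^ 2 ^ 2"
  where "time_dependent_metric a b x =
    (\<chi> i j. if i = 0 \<and> j = 0 then - a (x $ 0) else if i = 1 \<and> j = 1 then b (x $ 0) else 0)"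

end

theory Submission imports Defs begin

text \<open>
  Along a geodesic the momentum \<open>L = b(x\<^sup>0) (x\<^sup>1)'\<close> and the energy
  \<open>E = - a(x\<^sup>0) ((x\<^sup>0)')\<^sup>2 + b(x\<^sup>0) ((x\<^sup>1)')\<^sup>2\<close> are conserved. Hence
  \<open>a(x\<^sup>0) ((x\<^sup>0)')\<^sup>2 = L\<^sup>2 / b(x\<^sup>0) - E\<close>, and for a causal initial velocity the right-hand side is
  positive, as a function of \<open>x\<^sup>0\<close>, on the whole line. So \<open>(x\<^sup>0)'\<close> has constant sign, and
  separation of variables determines \<open>x\<^sup>0\<close>; then \<open>(x\<^sup>1)' = L / b(x\<^sup>0)\<close> determines \<open>x\<^sup>1\<close>. Thus
  the geodesic initial value problem is uniquely solvable for causal initial velocities, although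
  the Christoffel symbols are merely continuous.
\<close>

section \<open>Preliminaries: the index type \<open>2\<close>, scalar differential equations, matrix
  inverses\<close>

lemma UNIV_2_eq: "(UNIV :: 2 set) = {0, 1}"
proof -
  have "(2 :: 2) = 0" by simp
  then show ?thesis by (metis UNIV_2 insert_commute)
qed

lemma sum_UNIV_2: "(\<Sum>i\<in>(UNIV :: 2 set). f i) = f 0 + f 1"
  by (simp add: UNIV_2_eq)

lemma vec_eq_iff_2: "x = y \<longleftrightarrow> x $ 0 = y $ 0 \<and> x $ 1 = y $ 1" for x y :: "'a ^ 2"
  by (metis UNIV_2_eq UNIV_I empty_iff insert_iff vec_eq_iff)

lemma derivative_zero_constant_on:
  fixes f :: "real \<Rightarrow> real"
  assumes "\<And>t. t \<in> I \<Longrightarrow> (f has_real_derivative 0) (at t within I)"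
    and "convex I" and "s \<in> I" and "t \<in> I"
  shows "f s = f t"
  using has_field_derivative_zero_constant[OF assms(2,1)] assms(3,4) by auto

text \<open>Separation of variables: for an antiderivative \<open>G\<close> of \<open>f\<close>, the
  difference of \<open>G \<circ> x\<close> and \<open>G \<circ> y\<close> has derivative zero, and
  \<open>G\<close> is injective because \<open>f\<close> is positive. This takes the place of a
  Lipschitz condition. The interval \<open>I\<close> may be closed and \<open>t0\<close> may be an
  end point of it.\<close>

lemma separable_ode_unique:
  fixes f x y :: "real \<Rightarrow> real"
  assumes cont: "continuous_on UNIV f" and pos: "\<And>s. f s > 0"
    and "convex I" and "t0 \<in> I" and init: "x t0 = y t0"
    and x: "\<And>t. t \<in> I \<Longrightarrow> (x has_real_derivative x' t) (at t within I)"
    and y: "\<And>t. t \<in> I \<Longrightarrow> (y has_real_derivative y' t) (at t within I)"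
    and eq: "\<And>t. t \<in> I \<Longrightarrow> f (x t) * x' t = f (y t) * y' t"
    and "t \<in> I"
  shows "x t = y t"
proof -
  \<comment> \<open>The infinite end points give one antiderivative on the whole line, so no bound
    on the ranges of \<open>x\<close> and \<open>y\<close> enters.\<close>
  obtain G where "\<And>s. (G has_vector_derivative f s) (at s)"
    using einterval_antiderivative[of "-\<infinity>" "\<infinity>" f] cont
    by (auto simp: continuous_on_eq_continuous_at)
  then have G: "(G has_real_derivative f s) (at s)" for s
    by (simp add: has_real_derivative_iff_has_vector_derivative)
  have "strict_mono G"
    by (rule strict_monoI, rule DERIV_pos_imp_increasing) (use G pos in blast)+
  have "((\<lambda>t. G (x t) - G (y t)) has_real_derivative 0) (at t within I)" if "t \<in> I" for t
    using DERIV_diff[OF DERIV_chain2[OF G x[OF that]] DERIV_chain2[OF G y[OF that]]] eq[OF that]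
    by simp
  then have "G (x t) - G (y t) = G (x t0) - G (y t0)"
    by (rule derivative_zero_constant_on) (assumption | fact)+
  then have "G (x t) = G (y t)"
    using init by simp
  then show ?thesis
    using \<open>strict_mono G\<close> by (simp add: strict_mono_eq)
qed

text \<open>A continuous function with finite range is constant on a connected set. This is what
  fixes the sign of \<open>(x\<^sup>0)'\<close> once its square is known.\<close>

lemma continuous_square_one_constant:
  fixes h :: "real \<Rightarrow> real"
  assumes "connected I" and "continuous_on I h" and "\<And>t. t \<in> I \<Longrightarrow> (h t)\<^sup>2 = 1"
    and "s \<in> I" and "t \<in> I"
  shows "h s = h t"
proof -
  have "finite (h ` I)"
    by (rule finite_subset[of _ "{-1, 1}"]) (use assms(3) power2_eq_1_iff in auto)
  then have "h constant_on I"
    using continuous_finite_range_constant[OF assms(1,2)] by blast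
  then show ?thesis
    using assms(4,5) by (auto simp: constant_on_def)
qed

text \<open>\<open>matrix_inv\<close> is a Hilbert choice; two-sided inverses are unique, so any one
  that is exhibited must be the chosen one.\<close>

lemma matrix_inv_eqI:
  fixes A B :: "'a::semiring_1 ^ 'n ^ 'n"
  assumes "A ** B = mat 1" and "B ** A = mat 1"
  shows "matrix_inv A = B"
proof -
  have "A ** matrix_inv A = mat 1 \<and> matrix_inv A ** A = mat 1"
    unfolding matrix_inv_def by (rule someI[of _ B]) (use assms in simp)
  then show ?thesis
    using assms by (metis matrix_mul_assoc matrix_mul_lid matrix_mul_rid)
qed

section \<open>Christoffel symbols and the geodesic equations in coordinates\<close>

locale time_dependent_spacetime =
  fixes a b a' b' :: "real \<Rightarrow> real"
  assumes a_deriv: "\<And>s. (a has_real_derivative a' s) (at s)"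
    and b_deriv: "\<And>s. (b has_real_derivative b' s) (at s)"
    and a_pos: "\<And>s. a s > 0" and b_pos: "\<And>s. b s > 0"
begin

abbreviation g where "g \<equiv> time_dependent_metric a b"

lemma metric_component:
  "g x $ 0 $ 0 = - a (x $ 0)" "g x $ 0 $ 1 = 0" "g x $ 1 $ 0 = 0" "g x $ 1 $ 1 = b (x $ 0)"
  by (auto simp: time_dependent_metric_def)

lemma metric_inv_component:
  "matrix_inv (g x) $ 0 $ 0 = - 1 / a (x $ 0)" "matrix_inv (g x) $ 0 $ 1 = 0"
  "matrix_inv (g x) $ 1 $ 0 = 0" "matrix_inv (g x) $ 1 $ 1 = 1 / b (x $ 0)"
proof -
  define h :: "real ^ 2 ^ 2" where
    "h = (\<chi> i j. if i = 0 \<and> j = 0 then - 1 / a (x $ 0) else if i = 1 \<and> j = 1 then 1 / b (x $ 0) else 0)"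
  have "a (x $ 0) \<noteq> 0" "b (x $ 0) \<noteq> 0"
    using a_pos b_pos by (metis less_irrefl)+
  then have "g x ** h = mat 1" "h ** g x = mat 1"
    by (simp_all add: vec_eq_iff_2 matrix_matrix_mult_def sum_UNIV_2 mat_def h_def
        time_dependent_metric_def)
  then have "matrix_inv (g x) = h"
    by (rule matrix_inv_eqI)
  then show
    "matrix_inv (g x) $ 0 $ 0 = - 1 / a (x $ 0)" "matrix_inv (g x) $ 0 $ 1 = 0"
    "matrix_inv (g x) $ 1 $ 0 = 0" "matrix_inv (g x) $ 1 $ 1 = 1 / b (x $ 0)"
    by (simp_all add: h_def)
qed

lemma coord_deriv_time_function:
  assumes "\<And>s. (f has_real_derivative f' s) (at s)"
  shows "coord_deriv 0 (\<lambda>y :: real ^ 2. f (y $ 0)) x = f' (x $ 0)"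
    and "coord_deriv 1 (\<lambda>y :: real ^ 2. f (y $ 0)) x = 0"
proof -
  have "((\<lambda>h. f (x $ 0 + h)) has_real_derivative f' (x $ 0)) (at 0)"
    using assms[of "x $ 0"] DERIV_at_within_shift[of f "f' (x $ 0)" "x $ 0" 0 UNIV] by simp
  then show "coord_deriv 0 (\<lambda>y :: real ^ 2. f (y $ 0)) x = f' (x $ 0)"
    by (simp add: coord_deriv_def axis_def DERIV_imp_deriv)
  show "coord_deriv 1 (\<lambda>y :: real ^ 2. f (y $ 0)) x = 0"
    by (simp add: coord_deriv_def axis_def)
qed

lemma coord_deriv_zero: "coord_deriv i (\<lambda>y. 0) x = 0"
  by (simp add: coord_deriv_def)

lemma christoffel_component:
  "christoffel g 0 0 0 x = a' (x $ 0) / (2 * a (x $ 0))"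
  "christoffel g 0 0 1 x = 0"
  "christoffel g 0 1 0 x = 0"
  "christoffel g 0 1 1 x = b' (x $ 0) / (2 * a (x $ 0))"
  "christoffel g 1 0 0 x = 0"
  "christoffel g 1 0 1 x = b' (x $ 0) / (2 * b (x $ 0))"
  "christoffel g 1 1 0 x = b' (x $ 0) / (2 * b (x $ 0))"
  "christoffel g 1 1 1 x = 0"
proof -
  have "((\<lambda>s. - a s) has_real_derivative - a' s) (at s)" for s
    by (rule DERIV_minus[OF a_deriv])
  note D = coord_deriv_time_function[OF this] coord_deriv_time_function[OF b_deriv]
    coord_deriv_zero metric_component metric_inv_component
  show
    "christoffel g 0 0 0 x = a' (x $ 0) / (2 * a (x $ 0))"
    "christoffel g 0 0 1 x = 0"
    "christoffel g 0 1 0 x = 0"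
    "christoffel g 0 1 1 x = b' (x $ 0) / (2 * a (x $ 0))"
    "christoffel g 1 0 0 x = 0"
    "christoffel g 1 0 1 x = b' (x $ 0) / (2 * b (x $ 0))"
    "christoffel g 1 1 0 x = b' (x $ 0) / (2 * b (x $ 0))"
    "christoffel g 1 1 1 x = 0"
    by (simp_all add: christoffel_def sum_UNIV_2 D)
qed

lemma metric_form_eq:
  "metric_form g x v v = - a (x $ 0) * (v $ 0)\<^sup>2 + b (x $ 0) * (v $ 1)\<^sup>2"
  by (simp add: metric_form_def sum_UNIV_2 metric_component power2_eq_square)

text \<open>The two geodesic equations are multiplied by \<open>2 * a\<close> and \<open>b\<close>,
  which clears the denominators of the Christoffel symbols and leaves exactly the expressions that
  occur in the derivatives of energy and momentum.\<close>

lemma geodesic_onD: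
  assumes "geodesic_on g I \<gamma>" and "t \<in> I"
  defines "v \<equiv> velocity I \<gamma>" and "w \<equiv> velocity I (velocity I \<gamma>)"
  shows "((\<lambda>t. \<gamma> t $ i) has_real_derivative v t $ i) (at t within I)"
    and "((\<lambda>t. v t $ i) has_real_derivative w t $ i) (at t within I)"
    and "2 * a (\<gamma> t $ 0) * w t $ 0 + a' (\<gamma> t $ 0) * (v t $ 0)\<^sup>2 + b' (\<gamma> t $ 0) * (v t $ 1)\<^sup>2 = 0"
    and "b (\<gamma> t $ 0) * w t $ 1 + b' (\<gamma> t $ 0) * v t $ 0 * v t $ 1 = 0"
proof -
  have "(\<gamma> has_vector_derivative v t) (at t within I)"
    "(v has_vector_derivative w t) (at t within I)"
    using assms
    by (auto simp: geodesic_on_def C2_curve_on_def velocity_def differentiable_on_def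
        simp flip: vector_derivative_works)
  then show "((\<lambda>t. \<gamma> t $ i) has_real_derivative v t $ i) (at t within I)"
    "((\<lambda>t. v t $ i) has_real_derivative w t $ i) (at t within I)"
    unfolding has_real_derivative_iff_has_vector_derivative
    by (auto intro: bounded_linear.has_vector_derivative[OF bounded_linear_vec_nth])
  have pos: "a (\<gamma> t $ 0) > 0" "b (\<gamma> t $ 0) > 0"
    using a_pos b_pos by auto
  have eq: "w t $ k + (\<Sum>i\<in>UNIV. \<Sum>j\<in>UNIV. christoffel g k i j (\<gamma> t) * v t $ i * v t $ j) = 0" for k
    using assms by (auto simp: geodesic_on_def)
  show "2 * a (\<gamma> t $ 0) * w t $ 0 + a' (\<gamma> t $ 0) * (v t $ 0)\<^sup>2 + b' (\<gamma> t $ 0) * (v t $ 1)\<^sup>2 = 0"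
    using eq[of 0] pos
    by (simp add: sum_UNIV_2 christoffel_component field_simps power2_eq_square)
  show "b (\<gamma> t $ 0) * w t $ 1 + b' (\<gamma> t $ 0) * v t $ 0 * v t $ 1 = 0"
    using eq[of 1] pos
    by (simp add: sum_UNIV_2 christoffel_component field_simps)
qed

section \<open>Conservation laws and uniqueness for causal initial velocities\<close>

lemma momentum_conserved:
  assumes geo: "geodesic_on g I \<gamma>" and "convex I" and "s \<in> I" and "t \<in> I"
  shows "b (\<gamma> s $ 0) * velocity I \<gamma> s $ 1 = b (\<gamma> t $ 0) * velocity I \<gamma> t $ 1"
proof -
  have "((\<lambda>t. b (\<gamma> t $ 0) * velocity I \<gamma> t $ 1) has_real_derivative 0) (at t within I)"
    if "t \<in> I" for t
    \<comment> \<open>By the product rule the derivative is the left-hand side of the second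
      geodesic equation.\<close>
    using DERIV_mult[OF DERIV_chain2[OF b_deriv geodesic_onD(1)[OF geo that, of 0]]
        geodesic_onD(2)[OF geo that, of 1]] geodesic_onD(4)[OF geo that]
    by (simp add: algebra_simps)
  then show ?thesis
    by (rule derivative_zero_constant_on) (assumption | fact)+
qed

lemma energy_conserved:
  assumes geo: "geodesic_on g I \<gamma>" and "convex I" and "s \<in> I" and "t \<in> I"
  shows "metric_form g (\<gamma> s) (velocity I \<gamma> s) (velocity I \<gamma> s) =
    metric_form g (\<gamma> t) (velocity I \<gamma> t) (velocity I \<gamma> t)"
proof -
  have "((\<lambda>t. metric_form g (\<gamma> t) (velocity I \<gamma> t) (velocity I \<gamma> t)) has_real_derivative 0)
      (at t within I)" if "t \<in> I" for t
  proof -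
    define v w where "v = velocity I \<gamma>" and "w = velocity I v"
    note D = geodesic_onD[OF geo that, folded v_def w_def]
    define x where "x = \<gamma> t $ 0"
    have "((\<lambda>t. - a (\<gamma> t $ 0) * (v t $ 0)\<^sup>2 + b (\<gamma> t $ 0) * (v t $ 1)\<^sup>2) has_real_derivative
        - (a' x * v t $ 0) * (v t $ 0)\<^sup>2 - a x * (2 * v t $ 0 * w t $ 0)
        + (b' x * v t $ 0) * (v t $ 1)\<^sup>2 + b x * (2 * v t $ 1 * w t $ 1)) (at t within I)"
      unfolding x_def
      by (auto intro!: derivative_eq_intros DERIV_chain2[OF a_deriv D(1)]
          DERIV_chain2[OF b_deriv D(1)] D(2))
    \<comment> \<open>The derivative of the energy is a combination of the two geodesic equations
      with coefficients \<open>- v t $ 0\<close> and \<open>2 * v t $ 1\<close>; the second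
      contributes the \<open>b'\<close> term twice, the first removes it once.\<close>
    also have "- (a' x * v t $ 0) * (v t $ 0)\<^sup>2 - a x * (2 * v t $ 0 * w t $ 0)
        + (b' x * v t $ 0) * (v t $ 1)\<^sup>2 + b x * (2 * v t $ 1 * w t $ 1)
      = - v t $ 0 * (2 * a x * w t $ 0 + a' x * (v t $ 0)\<^sup>2 + b' x * (v t $ 1)\<^sup>2)
        + 2 * v t $ 1 * (b x * w t $ 1 + b' x * v t $ 0 * v t $ 1)"
      by (simp add: algebra_simps power2_eq_square)
    also have "\<dots> = 0"
      using D(3,4) by (simp add: x_def)
    finally show ?thesis
      by (simp add: metric_form_eq v_def)
  qed
  then show ?thesis
    by (rule derivative_zero_constant_on) (assumption | fact)+
qed

text \<open>
  \<open>f x \<cdot> x' = \<plusminus>1\<close> along a causal geodesic with momentum \<open>L\<close> and energy \<open>E\<close>, where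
  \<open>f = sqrt (a / (L\<^sup>2 / b - E))\<close>.
\<close>

lemma geodesic_speed_constant:
  assumes geo: "geodesic_on g I \<gamma>" and "convex I" and "t0 \<in> I" and "t \<in> I"
    and L: "L = b (\<gamma> t0 $ 0) * velocity I \<gamma> t0 $ 1"
    and E: "E = metric_form g (\<gamma> t0) (velocity I \<gamma> t0) (velocity I \<gamma> t0)"
    and pos: "\<And>s. L\<^sup>2 / b s - E > 0"
  defines "f \<equiv> \<lambda>s. sqrt (a s / (L\<^sup>2 / b s - E))"
  assumes cont: "continuous_on UNIV f"
  shows "f (\<gamma> t $ 0) * velocity I \<gamma> t $ 0 = f (\<gamma> t0 $ 0) * velocity I \<gamma> t0 $ 0"
proof (rule continuous_square_one_constant[where I = I
      and h = "\<lambda>t. f (\<gamma> t $ 0) * velocity I \<gamma> t $ 0"])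
  show "connected I"
    using \<open>convex I\<close> by (rule convex_connected)
  show "continuous_on I (\<lambda>t. f (\<gamma> t $ 0) * velocity I \<gamma> t $ 0)"
    using DERIV_continuous_on[OF geodesic_onD(1)[OF geo]]
      DERIV_continuous_on[OF geodesic_onD(2)[OF geo]]
    by (intro continuous_on_mult continuous_on_compose2[OF cont]) auto
  show "(f (\<gamma> t $ 0) * velocity I \<gamma> t $ 0)\<^sup>2 = 1" if "t \<in> I" for t
  proof -
    define x v0 v1 where "x = \<gamma> t $ 0" and "v0 = velocity I \<gamma> t $ 0" and "v1 = velocity I \<gamma> t $ 1"
    have "L = b x * v1" "E = - a x * v0\<^sup>2 + b x * v1\<^sup>2"
      using momentum_conserved[OF geo \<open>convex I\<close> \<open>t0 \<in> I\<close> that]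
        energy_conserved[OF geo \<open>convex I\<close> \<open>t0 \<in> I\<close> that]
      by (simp_all add: L E metric_form_eq x_def v0_def v1_def)
    \<comment> \<open>Since \<open>L\<^sup>2 / b x = b x * v1\<^sup>2\<close>, subtracting
      \<open>E\<close> cancels the spatial part.\<close>
    then have "L\<^sup>2 / b x - E = a x * v0\<^sup>2"
      using b_pos[of x] by (simp add: field_simps power2_eq_square)
    moreover have "(f x)\<^sup>2 = a x / (L\<^sup>2 / b x - E)"
      using a_pos[of x] pos[of x] by (simp add: f_def)
    ultimately have "(f x * v0)\<^sup>2 = 1"
      using a_pos[of x] pos[of x] by (auto simp: power_mult_distrib)
    then show ?thesis
      by (simp add: x_def v0_def)
  qed
qed (fact \<open>t \<in> I\<close> \<open>t0 \<in> I\<close>)+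

text \<open>Only \<gamma> is assumed causal, and only at \<open>t0\<close>: \<sigma> has the same
  initial data, hence the same \<open>L\<close> and \<open>E\<close>, and these determine
  \<open>f\<close>. This matches the definition of branching, where the competitor may be any
  geodesic.\<close>

theorem causal_geodesic_unique:
  assumes \<gamma>: "geodesic_on g I \<gamma>" and \<sigma>: "geodesic_on g I \<sigma>" and "convex I" and "t0 \<in> I"
    and causal: "causal_vector g (\<gamma> t0) (velocity I \<gamma> t0)"
    and pos_eq: "\<gamma> t0 = \<sigma> t0" and vel_eq: "velocity I \<gamma> t0 = velocity I \<sigma> t0"
    and "t \<in> I"
  shows "\<gamma> t = \<sigma> t"
proof -
  define L where "L = b (\<gamma> t0 $ 0) * velocity I \<gamma> t0 $ 1"
  define E where "E = metric_form g (\<gamma> t0) (velocity I \<gamma> t0) (velocity I \<gamma> t0)"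
  define f where "f = (\<lambda>s. sqrt (a s / (L\<^sup>2 / b s - E)))"
  have "E \<le> 0"
    using causal by (simp add: causal_vector_def E_def)
  \<comment> \<open>Here the nontriviality of a causal vector enters: \<open>L = 0\<close> makes the
    spatial component vanish, and then \<open>E = 0\<close> makes the time component vanish
    too.\<close>
  have "L \<noteq> 0 \<or> E < 0"
  proof (rule ccontr)
    assume "\<not> (L \<noteq> 0 \<or> E < 0)"
    then have "velocity I \<gamma> t0 = 0"
      using \<open>E \<le> 0\<close> a_pos[of "\<gamma> t0 $ 0"] b_pos[of "\<gamma> t0 $ 0"]
      by (auto simp: L_def E_def metric_form_eq vec_eq_iff_2 zero_less_mult_iff)
    then show False
      using causal by (simp add: causal_vector_def)
  qed
  have pos: "L\<^sup>2 / b s - E > 0" for s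
  proof (cases "L = 0")
    case False
    then have "L\<^sup>2 / b s > 0"
      using b_pos by simp
    then show ?thesis
      using \<open>E \<le> 0\<close> by linarith
  qed (use \<open>L \<noteq> 0 \<or> E < 0\<close> in auto)
  have "continuous_on UNIV a" "continuous_on UNIV b"
    using a_deriv b_deriv by (blast intro: DERIV_continuous_on)+
  then have cont: "continuous_on UNIV f"
    unfolding f_def using b_pos pos by (auto intro!: continuous_intros simp: less_imp_neq[THEN not_sym])
  have f_pos: "f s > 0" for s
    using a_pos pos by (simp add: f_def)
  have "f (\<gamma> t $ 0) * velocity I \<gamma> t $ 0 = f (\<sigma> t $ 0) * velocity I \<sigma> t $ 0" if "t \<in> I" for t
    using geodesic_speed_constant[OF \<gamma> \<open>convex I\<close> \<open>t0 \<in> I\<close> that, of L E]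
      geodesic_speed_constant[OF \<sigma> \<open>convex I\<close> \<open>t0 \<in> I\<close> that, of L E] pos cont
    by (simp add: L_def E_def f_def pos_eq vel_eq)
  then have x_eq: "\<gamma> t $ 0 = \<sigma> t $ 0" if "t \<in> I" for t
    using separable_ode_unique[OF cont f_pos \<open>convex I\<close> \<open>t0 \<in> I\<close> _
        geodesic_onD(1)[OF \<gamma>] geodesic_onD(1)[OF \<sigma>] _ that] pos_eq by simp
  have "velocity I \<gamma> t $ 1 = velocity I \<sigma> t $ 1" if "t \<in> I" for t
    using momentum_conserved[OF \<gamma> \<open>convex I\<close> \<open>t0 \<in> I\<close> that]
      momentum_conserved[OF \<sigma> \<open>convex I\<close> \<open>t0 \<in> I\<close> that] b_pos[of "\<sigma> t $ 0"]
    by (simp add: pos_eq vel_eq x_eq[OF that])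
  \<comment> \<open>With the constant weight 1, the separable equation reduces to two functions with
    equal derivatives and equal initial values.\<close>
  then have "\<gamma> t $ 1 = \<sigma> t $ 1"
    using separable_ode_unique[of "\<lambda>_. 1", OF _ _ \<open>convex I\<close> \<open>t0 \<in> I\<close> _
        geodesic_onD(1)[OF \<gamma>] geodesic_onD(1)[OF \<sigma>] _ \<open>t \<in> I\<close>] pos_eq by simp
  then show ?thesis
    using x_eq[OF \<open>t \<in> I\<close>] by (simp add: vec_eq_iff_2)
qed

end

section \<open>Restriction to open subintervals and one-sided velocities\<close>

lemma velocity_open_subset:
  assumes "open J" and "J \<subseteq> I" and "t \<in> J"
  shows "velocity I \<gamma> t = velocity J \<gamma> t"
  unfolding velocity_def using assms
  by (metis at_within_interior interiorI interior_open)

lemma differentiable_on_cong: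
  assumes "f differentiable_on S" and "\<And>x. x \<in> S \<Longrightarrow> f x = h x"
  shows "h differentiable_on S"
  using assms by (metis differentiable_on_def differentiable_transform_within zero_less_one)

text \<open>In branching, \<gamma> lives on a closed interval and \<sigma> on an open one, while
  \<open>velocity\<close> depends on the interval. On an open \<open>J\<close> all derivatives are
  two-sided, so both notions agree there.\<close>

lemma geodesic_on_open_subset:
  assumes "geodesic_on g I \<gamma>" and "open J" and "J \<subseteq> I"
  shows "geodesic_on g J \<gamma>"
proof -
  have v: "velocity I \<gamma> t = velocity J \<gamma> t" if "t \<in> J" for t
    using assms(2,3) that by (rule velocity_open_subset)
  have w: "velocity I (velocity I \<gamma>) t = velocity J (velocity J \<gamma>) t" if "t \<in> J" for t
  proof -
    have "velocity I (velocity I \<gamma>) t = velocity J (velocity I \<gamma>) t"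
      using assms(2,3) that by (rule velocity_open_subset)
    \<comment> \<open>The two inner velocities are known to agree only on \<open>J\<close>, which
      suffices because \<open>J\<close> is a neighborhood of \<open>t\<close>.\<close>
    also have "\<dots> = velocity J (velocity J \<gamma>) t"
      unfolding velocity_def[of J "velocity _ _"]
      by (rule vector_derivative_cong_eq)
        (use v that in \<open>auto simp: eventually_at_topological intro: assms(2)\<close>)
    finally show ?thesis .
  qed
  have diff: "\<gamma> differentiable_on J" "velocity I \<gamma> differentiable_on J"
    and cont: "continuous_on J (velocity I (velocity I \<gamma>))"
    using assms(1,3) unfolding geodesic_on_def C2_curve_on_def
    by (blast intro: differentiable_on_subset continuous_on_subset)+
  have "velocity J \<gamma> differentiable_on J"
    by (rule differentiable_on_cong[OF diff(2) v])
  moreover have "continuous_on J (velocity J (velocity J \<gamma>))"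
    by (rule continuous_on_eq[OF cont w])
  ultimately have "C2_curve_on J \<gamma>"
    unfolding C2_curve_on_def using diff(1) by blast
  moreover have "velocity J (velocity J \<gamma>) t $ k + (\<Sum>i\<in>UNIV. \<Sum>j\<in>UNIV.
      christoffel g k i j (\<gamma> t) * velocity J \<gamma> t $ i * velocity J \<gamma> t $ j) = 0"
    if "t \<in> J" for t k
    using assms(1,3) that unfolding geodesic_on_def v[OF that, symmetric] w[OF that, symmetric]
    by blast
  ultimately show ?thesis
    unfolding geodesic_on_def by blast
qed

text \<open>The velocity of a differentiable curve is already determined by its left derivative,
  which sees only the common past.\<close>

lemma velocity_eq_of_past_eq:
  fixes \<gamma> \<sigma> :: "real \<Rightarrow> real ^ 'n"
  assumes "\<epsilon> > 0" and "\<gamma> differentiable_on {t0 - \<epsilon><..<t0 + \<epsilon>}"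
    and "\<sigma> differentiable_on {t0 - \<epsilon><..<t0 + \<epsilon>}"
    and past: "\<And>t. t \<in> {t0 - \<epsilon><..t0} \<Longrightarrow> \<gamma> t = \<sigma> t"
  shows "velocity {t0 - \<epsilon><..<t0 + \<epsilon>} \<gamma> t0 = velocity {t0 - \<epsilon><..<t0 + \<epsilon>} \<sigma> t0"
proof -
  define I where "I = {t0 - \<epsilon><..<t0 + \<epsilon>}"
  define P where "P = {t0 - \<epsilon><..t0}"
  have "P \<subseteq> I" "t0 \<in> I" "t0 \<in> P"
    using \<open>\<epsilon> > 0\<close> by (auto simp: P_def I_def)
  have deriv: "(h has_vector_derivative velocity I h t0) (at t0 within P)"
    if "h differentiable_on I" for h :: "real \<Rightarrow> real ^ 'n"
    using that \<open>t0 \<in> I\<close> \<open>P \<subseteq> I\<close> unfolding velocity_def differentiable_on_def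
    by (blast intro: vector_derivative_works[THEN iffD1] has_vector_derivative_within_subset)
  have "(\<gamma> has_vector_derivative velocity I \<gamma> t0) (at t0 within P)"
    "(\<sigma> has_vector_derivative velocity I \<sigma> t0) (at t0 within P)"
    using assms(2,3) by (simp_all add: deriv I_def[symmetric])
  moreover from this(2) have "(\<gamma> has_vector_derivative velocity I \<sigma> t0) (at t0 within P)"
    by (rule has_vector_derivative_transform[rotated 2]) (use \<open>t0 \<in> P\<close> past P_def in auto)
  \<comment> \<open>Derivatives within \<open>P\<close> are unique only if \<open>t0\<close> is a
    limit point of \<open>P\<close>; near \<open>t0\<close> the set \<open>P\<close> is a left
    half-line.\<close>
  moreover have "at t0 within P \<noteq> bot"
  proof -
    have "at t0 within P = at_left t0"
      unfolding P_def using \<open>\<epsilon> > 0\<close>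
      by (intro at_within_nhd[of _ "{t0 - \<epsilon><..}"]) auto
    then show ?thesis by simp
  qed
  ultimately show ?thesis
    unfolding I_def by (blast intro: vector_derivative_unique_within)
qed

section \<open>Both properties deduced from uniqueness\<close>

theorem theoremA2:
  fixes a b :: "real \<Rightarrow> real"
  assumes "a C1_differentiable_on UNIV" and "b C1_differentiable_on UNIV"
    and "\<And>s. a s > 0" and "\<And>s. b s > 0"
  shows "causally_non_branching (time_dependent_metric a b)
       \<and> non_intertwining (time_dependent_metric a b)"
proof -
  obtain a' b' where "time_dependent_spacetime a b a' b'"
    using assms unfolding C1_differentiable_on_def time_dependent_spacetime_def
    by (auto simp: has_real_derivative_iff_has_vector_derivative)
  then interpret time_dependent_spacetime a b a' b' .
  have "causally_non_branching g"
    unfolding causally_non_branching_def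
  proof (intro allI impI notI; elim conjE bexE)
    fix \<alpha> \<beta> t0 :: real and \<gamma> :: "real \<Rightarrow> real ^ 2"
    assume \<gamma>: "causal_geodesic_on g {\<alpha>..\<beta>} \<gamma>" and "branches_at g \<alpha> \<beta> \<gamma> t0"
    then obtain \<epsilon> \<sigma> where "\<epsilon> > 0" and sub: "{t0 - \<epsilon><..<t0 + \<epsilon>} \<subseteq> {\<alpha>..\<beta>}"
      and \<sigma>: "geodesic_on g {t0 - \<epsilon><..<t0 + \<epsilon>} \<sigma>"
      and past: "\<And>t. t \<in> {t0 - \<epsilon><..t0} \<Longrightarrow> \<gamma> t = \<sigma> t"
      and disj: "\<gamma> ` {t0<..<t0 + \<epsilon>} \<inter> \<sigma> ` {t0<..<t0 + \<epsilon>} = {}"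
      unfolding branches_at_def by blast
    define I where "I = {t0 - \<epsilon><..<t0 + \<epsilon>}"
    have "t0 \<in> I" "t0 + \<epsilon> / 2 \<in> I" "open I" "convex I"
      using \<open>\<epsilon> > 0\<close> by (auto simp: I_def)
    have "I \<subseteq> {\<alpha>..\<beta>}"
      using sub by (simp add: I_def)
    have geo: "geodesic_on g I \<gamma>"
      by (rule geodesic_on_open_subset[OF _ \<open>open I\<close> \<open>I \<subseteq> {\<alpha>..\<beta>}\<close>])
        (use \<gamma> causal_geodesic_on_def in blast)
    moreover have "causal_vector g (\<gamma> t0) (velocity I \<gamma> t0)"
      using \<gamma> \<open>t0 \<in> I\<close> \<open>I \<subseteq> {\<alpha>..\<beta>}\<close>
      unfolding causal_geodesic_on_def
        velocity_open_subset[OF \<open>open I\<close> \<open>I \<subseteq> {\<alpha>..\<beta>}\<close> \<open>t0 \<in> I\<close>, symmetric]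
      by blast
    moreover have "velocity I \<gamma> t0 = velocity I \<sigma> t0"
      unfolding I_def using geo \<sigma> \<open>\<epsilon> > 0\<close> past
      by (intro velocity_eq_of_past_eq) (auto simp: geodesic_on_def C2_curve_on_def I_def)
    moreover have "\<gamma> t0 = \<sigma> t0"
      using past \<open>\<epsilon> > 0\<close> by simp
    \<comment> \<open>One common point after \<open>t0\<close> contradicts the disjointness of the
      two images; the midpoint serves.\<close>
    ultimately have "\<gamma> (t0 + \<epsilon> / 2) = \<sigma> (t0 + \<epsilon> / 2)"
      using causal_geodesic_unique[OF _ \<sigma>[folded I_def] \<open>convex I\<close> \<open>t0 \<in> I\<close>]
        \<open>t0 + \<epsilon> / 2 \<in> I\<close> by blast
    moreover have "t0 + \<epsilon> / 2 \<in> {t0<..<t0 + \<epsilon>}"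
      using \<open>\<epsilon> > 0\<close> by simp
    ultimately show False
      using disj by (metis IntI empty_iff imageI)
  qed
  moreover have "\<gamma>1 t = \<gamma>2 t"
    if "causal_geodesic_on g {0..\<epsilon>} \<gamma>1" and "causal_geodesic_on g {0..\<epsilon>} \<gamma>2"
      and "\<gamma>1 0 = \<gamma>2 0" and "velocity {0..\<epsilon>} \<gamma>1 0 = velocity {0..\<epsilon>} \<gamma>2 0" and "t \<in> {0..\<epsilon>}"
    for \<epsilon> t \<gamma>1 \<gamma>2
  proof (rule causal_geodesic_unique)
    show "0 \<in> {0..\<epsilon>}"
      using that(5) by simp
    then show "causal_vector g (\<gamma>1 0) (velocity {0..\<epsilon>} \<gamma>1 0)"
      using that(1) unfolding causal_geodesic_on_def by blast
  qed (use that causal_geodesic_on_def in auto)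
  \<comment> \<open>Uniqueness is global, so the whole plane serves as the neighborhood and the
    first alternative always holds.\<close>
  then have "non_intertwining g"
    unfolding non_intertwining_def by (intro allI exI[of _ UNIV]) auto
  ultimately show ?thesis ..
qed

end
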